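(* Let $D=(P_1,\dots,P_n)$ be a sequence of $n$ distinct points $P_i=(\alpha_i,\beta_i)\in\mathbb N\times\mathbb N$, put $s_i=\alpha_i+\beta_i$ for $1\le i\le n$, and assume $s_1\le s_2\le\cdots\le s_n$. Put $d=\sum_{i=1}^n s_i$ and $s_{n+1}=n$. Suppose $1\le i\ne j\le n$ are two integers satisfying $s_i=i-1$, $s_{i+1}=i$, $s_j=j-1$, $s_{j+1}=j$, $\beta_i>0$ and $\alpha_j>0$. Let $D'$ be the sequence obtained from $D$ by replacing $P_i$ by $P_i+(1,-1)$ and $P_j$ by $P_j+(-1,1)$, leaving all other points unchanged. Then $\Delta(D)\sim\Delta(D')$ modulo $I_{<d}$, that is, $\Delta(D)-\Delta(D')\in I_{<d}$.
   Context: $\mathbb N$ is the set of nonnegative integers. $I=\bigcap_{1\le i<j\le n}(x_i-x_j,\,y_i-y_j)\subset\mathbb C[x_1,y_1,\dots,x_n,y_n]$, and $I_{<d}$ is the ideal of $\mathbb C[x_1,y_1,\dots,x_n,y_n]$ generated by the homogeneous elements of $I$ of degree less than $d$. For a sequence $D$ of $n$ points $(\alpha_1,\beta_1),\dots,(\alpha_n,\beta_n)$ of $\mathbb N\times\mathbb N$, $\Delta(D)=\det\big[x_i^{\alpha_j}y_i^{\beta_j}\big]_{1\le i,j\le n}$ (with columns in the order of the sequence; it is $0$ if two points coincide). *)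

theory Defs
  imports Complex_Main "HOL-Library.Poly_Mapping" "HOL-Algebra.Ideal"
    "Jordan_Normal_Form.Determinant"
begin

datatype var = Xvar nat | Yvar nat

type_synonym mpoly = "(var \<Rightarrow>\<^sub>0 nat) \<Rightarrow>\<^sub>0 complex"

definition indet :: "var \<Rightarrow> mpoly" where
  "indet v = Poly_Mapping.single (Poly_Mapping.single v 1) 1"

definition total_deg :: "(var \<Rightarrow>\<^sub>0 nat) \<Rightarrow> nat" where
  "total_deg m = (\<Sum>v \<in> Poly_Mapping.keys m. Poly_Mapping.lookup m v)"

text \<open>The zero polynomial is homogeneous of every degree.\<close>

definition homogeneous :: "nat \<Rightarrow> mpoly \<Rightarrow> bool" where
  "homogeneous k p \<longleftrightarrow> (\<forall>m \<in> Poly_Mapping.keys p. total_deg m = k)"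

text \<open>The type \<^typ>\<open>mpoly\<close> has infinitely many variables; the polynomial ring in
  \<open>x\<^sub>1, y\<^sub>1, \<dots>, x\<^sub>n, y\<^sub>n\<close> is the subring of polynomials whose monomials involve only these
  variables, and all ideals below are ideals of that subring.\<close>

definition vars_upto :: "nat \<Rightarrow> var set" where
  "vars_upto n = Xvar ` {1..n} \<union> Yvar ` {1..n}"

definition poly_ring :: "nat \<Rightarrow> mpoly ring" where
  "poly_ring n =
    \<lparr>carrier = {p. \<forall>m \<in> Poly_Mapping.keys p. Poly_Mapping.keys m \<subseteq> vars_upto n},
     monoid.mult = (*), one = 1, zero = 0, add = (+)\<rparr>"

text \<open>Intersecting with the carrier matters only for \<open>n \<le> 1\<close>, where the family is empty.\<close>

definition diag_ideal :: "nat \<Rightarrow> mpoly set" where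
  "diag_ideal n = carrier (poly_ring n) \<inter>
    (\<Inter>(i, j) \<in> {(i, j). 1 \<le> i \<and> i < j \<and> j \<le> n}.
      Idl\<^bsub>poly_ring n\<^esub> {indet (Xvar i) - indet (Xvar j), indet (Yvar i) - indet (Yvar j)})"

definition diag_ideal_below :: "nat \<Rightarrow> nat \<Rightarrow> mpoly set" where
  "diag_ideal_below n d = Idl\<^bsub>poly_ring n\<^esub> {f \<in> diag_ideal n. \<exists>k<d. homogeneous k f}"

text \<open>Matrices are indexed from \<open>0\<close>, whereas variables and points are indexed from \<open>1\<close>;
  only the values of \<open>P\<close> on \<open>{1..n}\<close> are used.\<close>

definition Delta :: "nat \<Rightarrow> (nat \<Rightarrow> nat \<times> nat) \<Rightarrow> mpoly" where
  "Delta n P = det (mat n n (\<lambda>(i, j).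
    indet (Xvar (i + 1)) ^ fst (P (j + 1)) * indet (Yvar (i + 1)) ^ snd (P (j + 1))))"

lemma cring_poly_ring: "cring (poly_ring n)"
proof -
  let ?C = "carrier (poly_ring n)"
  have mem: "p \<in> ?C \<longleftrightarrow>
      (\<forall>m \<in> Poly_Mapping.keys p. Poly_Mapping.keys m \<subseteq> vars_upto n)" for p
    by (simp add: poly_ring_def)
  have add: "p + q \<in> ?C" if "p \<in> ?C" "q \<in> ?C" for p q
    using that Poly_Mapping.keys_add[of p q] unfolding mem by blast
  have mult: "p * q \<in> ?C" if p: "p \<in> ?C" and q: "q \<in> ?C" for p q
    unfolding mem
  proof
    fix m assume "m \<in> Poly_Mapping.keys (p * q)"
    then obtain a b where "m = a + b" "a \<in> Poly_Mapping.keys p" "b \<in> Poly_Mapping.keys q"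
      using keys_mult[of p q] by blast
    then show "Poly_Mapping.keys m \<subseteq> vars_upto n"
      using p q Poly_Mapping.keys_add[of a b] unfolding mem by blast
  qed
  have uminus: "- p \<in> ?C" if "p \<in> ?C" for p
    using that by (simp add: mem)
  have zero: "0 \<in> ?C" by (simp add: mem)
  have one: "1 \<in> ?C" by (simp add: mem)
  note [simp] = add mult zero one
  have sel: "monoid.mult (poly_ring n) = (*)" "add (poly_ring n) = (+)"
      "\<one>\<^bsub>poly_ring n\<^esub> = 1" "\<zero>\<^bsub>poly_ring n\<^esub> = 0"
    by (simp_all add: poly_ring_def)
  show ?thesis
  proof (rule cringI)
    show "abelian_group (poly_ring n)"
    proof (rule abelian_groupI)
      fix p assume "p \<in> ?C"
      then show "\<exists>q \<in> ?C. q \<oplus>\<^bsub>poly_ring n\<^esub> p = \<zero>\<^bsub>poly_ring n\<^esub>"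
        using uminus[of p] by (intro bexI[of _ "- p"]) (simp_all add: sel)
    qed (simp_all add: sel algebra_simps)
    show "comm_monoid (poly_ring n)"
      by (rule comm_monoidI) (simp_all add: sel algebra_simps)
  qed (simp_all add: sel algebra_simps)
qed

end

theory Submission
  imports Defs
begin

text \<open>
  Modulo \<open>I\<^sub><\<^sub>d\<close>, only the leading form of each column of \<open>\<Delta>(D)\<close> matters. Suppose that an
  entry \<open>h(z\<^sub>r) x\<^sub>r\<close> of one column is replaced, for all \<open>r\<close> at once, by \<open>h(z\<^sub>r) (x\<^sub>r - k)\<close>
  with a linear form \<open>k\<close> independent of \<open>r\<close>, or likewise with \<open>y\<close>. The determinant changes by \<open>k\<close> times a determinant of
  degree \<open>d - 1\<close>, and that determinant lies in \<open>I\<close> because two of its rows become equal when two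
  of the points \<open>z\<^sub>r = (x\<^sub>r, y\<^sub>r)\<close> do (lemma \<open>coldet_shift_column\<close>).

  Number rows, columns and points from \<open>0\<close>, and let \<open>t\<^sub>c = s\<^sub>c\<^sub>+\<^sub>1\<close> be the degree of
  column \<open>c\<close>. Shifting every linear factor turns column \<open>c\<close> into a Newton-type product
  \<open>f\<^sub>c(z\<^sub>r) = \<Prod>\<^sub>l (v\<^sub>r - v\<^sub>l)\<close> over \<open>l < t\<^sub>c\<close> (where \<open>v\<^sub>l\<close> is read
  as \<open>0\<close> for \<open>l \<ge> n\<close>), in which \<open>v\<close> is \<open>x\<close> for \<open>\<alpha>\<close> of the indices \<open>l\<close> and \<open>y\<close> for the
  \<open>\<beta>\<close> others; which indices get which letter is free (lemma \<open>coldet_newton\<close>). Such a column vanishes in the rows \<open>r < t\<^sub>c\<close>.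

  As the degrees increase weakly, the hypotheses at \<open>i\<close> and \<open>j\<close> say that, in this
  numbering, \<open>t\<^sub>i = i\<close> and
  \<open>t\<^sub>c > i\<close> for \<open>c > i\<close>, and likewise for \<open>j\<close>. Hence the matrix is block triangular with
  \<open>1 \<times> 1\<close> blocks at \<open>i\<close> and \<open>j\<close>, and its determinant is \<open>f\<^sub>i(z\<^sub>i) f\<^sub>j(z\<^sub>j) W\<close>, where
  \<open>W\<close> does not involve the columns \<open>i\<close> and \<open>j\<close> (lemma \<open>coldet_factor_out\<close>). The move from
  \<open>D\<close> to \<open>D'\<close> changes the letter of one factor of \<open>f\<^sub>i\<close> and of one factor of \<open>f\<^sub>j\<close>.
  Let \<open>i < j\<close>, and take the factor with \<open>l = 0\<close> in \<open>f\<^sub>i\<close> and the one with \<open>l = i\<close> in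
  \<open>f\<^sub>j\<close>. Then the two determinants differ by a product of \<open>W\<close>, the other linear factors
  and \<open>(y\<^sub>i - y\<^sub>0) (x\<^sub>j - x\<^sub>i) - (x\<^sub>i - x\<^sub>0) (y\<^sub>j - y\<^sub>i)\<close>, the
  signed area form of the three points \<open>z\<^sub>0, z\<^sub>i, z\<^sub>j\<close>, which vanishes as soon as two of
  them coincide. Therefore the factor with \<open>l = 0\<close> in \<open>f\<^sub>j\<close> is superfluous: what remains
  without it still vanishes at every coincidence of two points, so it is an element of \<open>I\<close> of degree
  \<open>d - 1\<close> (lemma \<open>coldet_exchange\<close>). The case \<open>j < i\<close> is the same with \<open>D\<close> and \<open>D'\<close> exchanged.
\<close>

section \<open>Closure properties of ideals and of homogeneous polynomials\<close>

lemma mem_poly_ring: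
  "p \<in> carrier (poly_ring n) \<longleftrightarrow>
    (\<forall>m \<in> Poly_Mapping.keys p. Poly_Mapping.keys m \<subseteq> vars_upto n)"
  by (simp add: poly_ring_def)

lemma poly_ring_sel:
  "monoid.mult (poly_ring n) = (*)" "add (poly_ring n) = (+)"
  "\<one>\<^bsub>poly_ring n\<^esub> = 1" "\<zero>\<^bsub>poly_ring n\<^esub> = 0"
  by (simp_all add: poly_ring_def)

lemma ideal_carrier: "ideal (carrier (poly_ring n)) (poly_ring n)"
  by (rule ring.oneideal[OF cring.axioms(1)[OF cring_poly_ring]])

lemma carrier_mult:
  "p \<in> carrier (poly_ring n) \<Longrightarrow> q \<in> carrier (poly_ring n) \<Longrightarrow> p * q \<in> carrier (poly_ring n)"
  using monoid.m_closed[OF ring.is_monoid[OF cring.axioms(1)[OF cring_poly_ring]], of p n q]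
  by (simp add: poly_ring_sel)

lemma carrier_one: "1 \<in> carrier (poly_ring n)"
  by (simp add: mem_poly_ring)

context
  fixes n :: nat and K :: "mpoly set"
  assumes K: "ideal K (poly_ring n)"
begin

lemma ideal_add: "p \<in> K \<Longrightarrow> q \<in> K \<Longrightarrow> p + q \<in> K"
  using additive_subgroup.a_closed[OF ideal.axioms(1)[OF K], of p q] by (simp add: poly_ring_sel)

lemma ideal_zero: "0 \<in> K"
  using additive_subgroup.zero_closed[OF ideal.axioms(1)[OF K]] by (simp add: poly_ring_sel)

lemma ideal_mult_left: "p \<in> K \<Longrightarrow> q \<in> carrier (poly_ring n) \<Longrightarrow> q * p \<in> K"
  using ideal.I_l_closed[OF K, of p q] by (simp add: poly_ring_sel)

lemma ideal_mult_right: "p \<in> K \<Longrightarrow> q \<in> carrier (poly_ring n) \<Longrightarrow> p * q \<in> K"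
  using ideal_mult_left[of p q] by (simp add: mult.commute)

lemma ideal_uminus: "p \<in> K \<Longrightarrow> - p \<in> K"
  using ideal_mult_left[of p "- 1"] by (simp add: mem_poly_ring)

lemma ideal_diff: "p \<in> K \<Longrightarrow> q \<in> K \<Longrightarrow> p - q \<in> K"
  using ideal_add[of p "- q"] ideal_uminus by simp

lemma ideal_sum: "(\<And>a. a \<in> A \<Longrightarrow> f a \<in> K) \<Longrightarrow> sum f A \<in> K"
  by (induction A rule: infinite_finite_induct) (simp_all add: ideal_zero ideal_add)

end

lemmas carrier_zero = ideal_zero[OF ideal_carrier]
lemmas carrier_uminus = ideal_uminus[OF ideal_carrier]
lemmas carrier_diff = ideal_diff[OF ideal_carrier]

lemma carrier_prod:
  "(\<And>a. a \<in> A \<Longrightarrow> f a \<in> carrier (poly_ring n)) \<Longrightarrow> prod f A \<in> carrier (poly_ring n)"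
  by (induction A rule: infinite_finite_induct) (simp_all add: carrier_one carrier_mult)

lemma carrier_signof: "signof p \<in> carrier (poly_ring n)"
  by (simp add: sign_def carrier_one carrier_uminus)

lemma ideal_prod:
  assumes "ideal K (poly_ring n)" "finite A" "a \<in> A" "f a \<in> K"
    and "\<And>b. b \<in> A \<Longrightarrow> f b \<in> carrier (poly_ring n)"
  shows "prod f A \<in> K"
  using assms ideal_mult_right[OF assms(1,4) carrier_prod[of "A - {a}" f]]
  by (simp add: prod.remove)

lemma total_deg_add: "total_deg (a + b) = total_deg a + total_deg b"
proof -
  let ?S = "Poly_Mapping.keys a \<union> Poly_Mapping.keys b"
  have ext: "total_deg m = (\<Sum>v\<in>?S. Poly_Mapping.lookup m v)"
    if "Poly_Mapping.keys m \<subseteq> ?S" for m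
    unfolding total_deg_def using that
    by (intro sum.mono_neutral_left) (auto simp: in_keys_iff)
  show ?thesis
    using ext[of a] ext[of b] ext[of "a + b"] Poly_Mapping.keys_add[of a b]
    by (simp add: lookup_add sum.distrib)
qed

lemma homogeneous_zero: "homogeneous k 0"
  by (simp add: homogeneous_def)

lemma homogeneous_one: "homogeneous 0 1"
  by (simp add: homogeneous_def total_deg_def)

lemma homogeneous_add: "homogeneous k p \<Longrightarrow> homogeneous k q \<Longrightarrow> homogeneous k (p + q)"
  using Poly_Mapping.keys_add[of p q] by (auto simp: homogeneous_def)

lemma homogeneous_uminus: "homogeneous k p \<Longrightarrow> homogeneous k (- p)"
  by (simp add: homogeneous_def)

lemma homogeneous_diff: "homogeneous k p \<Longrightarrow> homogeneous k q \<Longrightarrow> homogeneous k (p - q)"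
  using homogeneous_add[of k p "- q"] homogeneous_uminus by simp

lemma homogeneous_mult: "homogeneous k p \<Longrightarrow> homogeneous l q \<Longrightarrow> homogeneous (k + l) (p * q)"
  using keys_mult[of p q] by (fastforce simp: homogeneous_def total_deg_add)

lemma homogeneous_sum: "(\<And>a. a \<in> A \<Longrightarrow> homogeneous k (f a)) \<Longrightarrow> homogeneous k (sum f A)"
  by (induction A rule: infinite_finite_induct) (simp_all add: homogeneous_zero homogeneous_add)

lemma homogeneous_prod:
  "(\<And>a. a \<in> A \<Longrightarrow> homogeneous (e a) (f a)) \<Longrightarrow> homogeneous (sum e A) (prod f A)"
  by (induction A rule: infinite_finite_induct) (simp_all add: homogeneous_one homogeneous_mult)

lemma homogeneous_signof: "homogeneous 0 (signof p)"
  by (simp add: sign_def homogeneous_one homogeneous_uminus)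

section \<open>The ideals of pairs of points\<close>

text \<open>
  The letter is a boolean (true for \<open>x\<close>) so that the choice of letters in a product is a predicate.
  Points are numbered from \<open>0\<close> from here on, like the rows of the matrix.
\<close>

definition coord :: "bool \<Rightarrow> nat \<Rightarrow> mpoly" where
  "coord t r = indet (if t then Xvar (r + 1) else Yvar (r + 1))"

definition pair_ideal :: "nat \<Rightarrow> nat \<Rightarrow> nat \<Rightarrow> mpoly set" where
  "pair_ideal n a b =
    Idl\<^bsub>poly_ring n\<^esub> {coord True a - coord True b, coord False a - coord False b}"

lemma coord_carrier: "r < n \<Longrightarrow> coord t r \<in> carrier (poly_ring n)"
  by (auto simp: coord_def indet_def mem_poly_ring vars_upto_def)

lemma coord_homogeneous: "homogeneous 1 (coord t r)"
  by (simp add: coord_def indet_def homogeneous_def total_deg_def)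

lemma
  assumes "a < n" "b < n"
  shows pair_ideal_ideal: "ideal (pair_ideal n a b) (poly_ring n)"
    and coord_diff_pair_ideal: "coord t a - coord t b \<in> pair_ideal n a b"
    and coord_diff_pair_ideal': "coord t b - coord t a \<in> pair_ideal n a b"
proof -
  let ?G = "{coord True a - coord True b, coord False a - coord False b}"
  have R: "ring (poly_ring n)"
    by (rule cring.axioms(1)[OF cring_poly_ring])
  have G: "?G \<subseteq> carrier (poly_ring n)"
    using assms by (simp add: coord_carrier carrier_diff)
  show I: "ideal (pair_ideal n a b) (poly_ring n)"
    unfolding pair_ideal_def by (rule ring.genideal_ideal[OF R G])
  show m: "coord t a - coord t b \<in> pair_ideal n a b"
    unfolding pair_ideal_def using ring.genideal_self[OF R G] by (cases t) auto
  show "coord t b - coord t a \<in> pair_ideal n a b"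
    using ideal_uminus[OF I m] by simp
qed

lemma diag_idealI:
  assumes "p \<in> carrier (poly_ring n)"
    and "\<And>a b. a < b \<Longrightarrow> b < n \<Longrightarrow> p \<in> pair_ideal n a b"
  shows "p \<in> diag_ideal n"
proof -
  have "p \<in> Idl\<^bsub>poly_ring n\<^esub> {indet (Xvar i) - indet (Xvar j), indet (Yvar i) - indet (Yvar j)}"
    if "1 \<le> i" "i < j" "j \<le> n" for i j
    using assms(2)[of "i - 1" "j - 1"] that by (simp add: pair_ideal_def coord_def)
  then show ?thesis
    using assms(1) by (auto simp: diag_ideal_def)
qed

lemma diag_ideal_below_ideal: "ideal (diag_ideal_below n d) (poly_ring n)"
  unfolding diag_ideal_below_def
  by (rule ring.genideal_ideal[OF cring.axioms(1)[OF cring_poly_ring]])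
    (auto simp: diag_ideal_def)

lemma diag_ideal_belowI:
  "p \<in> diag_ideal n \<Longrightarrow> homogeneous k p \<Longrightarrow> k < d \<Longrightarrow> p \<in> diag_ideal_below n d"
  unfolding diag_ideal_below_def
  using ring.genideal_self[OF cring.axioms(1)[OF cring_poly_ring],
      of "{f \<in> diag_ideal n. \<exists>k<d. homogeneous k f}" n]
  by (auto simp: diag_ideal_def)

section \<open>Determinants given by their columns\<close>

text \<open>
  Determinants are manipulated one column at a time, so the column index comes first: \<open>g c r\<close>
  is the entry in row \<open>r\<close> and column \<open>c\<close>, and \<open>g(c := u)\<close> replaces a column.
\<close>

definition coldet :: "nat \<Rightarrow> (nat \<Rightarrow> nat \<Rightarrow> mpoly) \<Rightarrow> mpoly" where
  "coldet n g = det (mat n n (\<lambda>(r, c). g c r))"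

lemma coldet_leibniz:
  "coldet n g = (\<Sum>p | p permutes {0..<n}. signof p * (\<Prod>c<n. g c (p c)))"
proof -
  have "(\<Prod>c<n. mat n n (\<lambda>(r, c). g c r) $$ (p c, c)) = (\<Prod>c<n. g c (p c))"
    if "p permutes {0..<n}" for p
    using permutes_in_image[OF that] by (intro prod.cong) auto
  then show ?thesis
    unfolding coldet_def by (subst det_col[of _ n]) auto
qed

lemma permutes_less: "p permutes {0..<n} \<Longrightarrow> p c < n \<longleftrightarrow> c < (n::nat)"
  using permutes_in_image[of p "{0..<n}" c] by simp

lemma coldet_cong: "(\<And>c r. c < n \<Longrightarrow> r < n \<Longrightarrow> g c r = h c r) \<Longrightarrow> coldet n g = coldet n h"
  unfolding coldet_leibniz
  by (intro sum.cong refl arg_cong2[where f = "(*)"] prod.cong) (auto simp: permutes_less)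

lemma coldet_linear:
  assumes "c < n"
  shows "coldet n (g(c := \<lambda>r. u r - k * v r)) = coldet n (g(c := u)) - k * coldet n (g(c := v))"
proof -
  have split: "(\<Prod>b<n. (g(c := w)) b (p b)) = w (p c) * (\<Prod>b\<in>{..<n} - {c}. g b (p b))" for w p
    using assms by (subst prod.remove[of _ c]) auto
  show ?thesis
    unfolding coldet_leibniz split
    by (simp add: sum_subtractf[symmetric] sum_distrib_left algebra_simps)
qed

lemma coldet_carrier:
  assumes "\<And>c r. c < n \<Longrightarrow> r < n \<Longrightarrow> g c r \<in> carrier (poly_ring n)"
  shows "coldet n g \<in> carrier (poly_ring n)"
  unfolding coldet_leibniz
  by (intro ideal_sum[OF ideal_carrier] carrier_mult carrier_prod carrier_signof)
    (auto simp: permutes_less assms)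

lemma coldet_homogeneous:
  assumes "\<And>c r. c < n \<Longrightarrow> r < n \<Longrightarrow> homogeneous (e c) (g c r)"
  shows "homogeneous (\<Sum>c<n. e c) (coldet n g)"
proof -
  have "homogeneous (0 + (\<Sum>c<n. e c)) (signof p * (\<Prod>c<n. g c (p c)))"
    if "p permutes {0..<n}" for p
    using that by (intro homogeneous_mult homogeneous_signof homogeneous_prod)
      (auto simp: permutes_less assms)
  then show ?thesis
    unfolding coldet_leibniz by (intro homogeneous_sum) simp
qed

lemma coldet_ideal:
  assumes K: "ideal K (poly_ring n)"
    and g: "\<And>c r. c < n \<Longrightarrow> r < n \<Longrightarrow> g c r \<in> carrier (poly_ring n)"
    and hit: "\<And>p. p permutes {0..<n} \<Longrightarrow> \<exists>c<n. g c (p c) \<in> K"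
  shows "coldet n g \<in> K"
  unfolding coldet_leibniz
proof (rule ideal_sum[OF K])
  fix p assume "p \<in> {p. p permutes {0..<n}}"
  then have p: "p permutes {0..<n}" by simp
  obtain c where "c < n" "g c (p c) \<in> K"
    using hit[OF p] by blast
  then have "(\<Prod>c<n. g c (p c)) \<in> K"
    using p by (intro ideal_prod[OF K, of _ c]) (auto simp: permutes_less g)
  then show "signof p * (\<Prod>c<n. g c (p c)) \<in> K"
    by (rule ideal_mult_left[OF K _ carrier_signof])
qed

text \<open>
  Subtracting row \<open>a\<close> from row \<open>b\<close> does not change the determinant and puts all of row \<open>b\<close>
  into \<open>K\<close>; every Leibniz term contains an entry of that row.
\<close>

lemma coldet_ideal_congruent_rows:
  assumes K: "ideal K (poly_ring n)"
    and g: "\<And>c r. c < n \<Longrightarrow> r < n \<Longrightarrow> g c r \<in> carrier (poly_ring n)"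
    and ab: "a < n" "b < n" "a \<noteq> b"
    and cong: "\<And>c. c < n \<Longrightarrow> g c b - g c a \<in> K"
  shows "coldet n g \<in> K"
proof -
  define h where "h = (\<lambda>c. (g c)(b := g c b - g c a))"
  have "coldet n g = det (addrow (- 1) b a (mat n n (\<lambda>(r, c). g c r)))"
    unfolding coldet_def using ab by (subst det_addrow[where n = n]) auto
  also have "addrow (- 1) b a (mat n n (\<lambda>(r, c). g c r)) = mat n n (\<lambda>(r, c). h c r)"
    using ab by (intro eq_matI) (auto simp: h_def)
  finally have "coldet n g = coldet n h"
    by (simp add: coldet_def)
  also have "coldet n h \<in> K"
  proof (rule coldet_ideal[OF K])
    show "h c r \<in> carrier (poly_ring n)" if "c < n" "r < n" for c r
      using that ab by (simp add: h_def g carrier_diff)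
    fix p assume p: "p permutes {0..<n}"
    define c where "c = Hilbert_Choice.inv p b"
    have "p c = b" "c < n"
      using permutes_inverses(1)[OF p, of b] permutes_less[OF p, of c] ab by (auto simp: c_def)
    then show "\<exists>c<n. h c (p c) \<in> K"
      using cong by (intro exI[of _ c]) (simp add: h_def)
  qed
  finally show ?thesis .
qed

text \<open>
  Columns and rows are cut after position \<open>a\<close>. A Leibniz term that uses an entry below the cut in one
  of the left columns must by counting use an entry above the cut in one of the right columns; in a
  block triangular matrix this entry is \<open>0\<close>.
\<close>

lemma permutes_crossing:
  assumes p: "p permutes {0..<n}" and c: "c \<le> a" "a < p c" "c < n"
  shows "\<exists>c'. a < c' \<and> c' < n \<and> p c' \<le> (a::nat)"
proof (rule ccontr)
  assume "\<not> ?thesis"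
  then have "p ` insert c {a<..<n} \<subseteq> {a<..<n}"
    using c permutes_less[OF p] by force
  then have "card (insert c {a<..<n}) \<le> card {a<..<n}"
    by (rule card_inj_on_le[OF permutes_inj_on[OF p]]) simp
  then show False
    using c by simp
qed

text \<open>
  The entry at \<open>(i, i)\<close> is a diagonal block of its own: the part of column \<open>i\<close> above it is zero,
  and a Leibniz term that uses an entry of column \<open>i\<close> below it dies by the crossing argument.
\<close>

lemma coldet_factor_out:
  assumes i: "i < n"
    and right: "\<And>c r. i < c \<Longrightarrow> c < n \<Longrightarrow> r \<le> i \<Longrightarrow> g c r = 0"
    and top: "\<And>r. r < i \<Longrightarrow> g i r = 0"
  shows "coldet n g = g i i * coldet n (g(i := \<lambda>r. if r = i then 1 else 0))"
    (is "_ = _ * coldet n ?h")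
proof -
  have "(\<Prod>c<n. g c (p c)) = g i i * (\<Prod>c<n. ?h c (p c))" if p: "p permutes {0..<n}" for p
  proof (cases "p i = i")
    case True
    have "(\<Prod>c\<in>{..<n} - {i}. ?h c (p c)) = (\<Prod>c\<in>{..<n} - {i}. g c (p c))"
      by (rule prod.cong) auto
    then show ?thesis
      using i True by (simp add: prod.remove[of "{..<n}" i])
  next
    case False
    have "\<exists>c<n. g c (p c) = 0"
    proof (cases "p i < i")
      case True
      then show ?thesis using top i by blast
    next
      case less: False
      with False have "i < p i" by simp
      from permutes_crossing[OF p order.refl this i] show ?thesis
        using right by blast
    qed
    then have "(\<Prod>c<n. g c (p c)) = 0"
      by (intro prod_zero) auto
    moreover have "(\<Prod>c<n. ?h c (p c)) = 0"
      using i False by (intro prod_zero) (auto intro!: bexI[of _ i])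
    ultimately show ?thesis by simp
  qed
  then show ?thesis
    unfolding coldet_leibniz by (simp add: sum_distrib_left mult.left_commute)
qed

section \<open>Shifting linear factors modulo lower degree\<close>

text \<open>
  An evaluation column behaves like the values at the points \<open>z\<^sub>r\<close> of one bivariate polynomial
  of degree \<open>e\<close> whose coefficients may be any elements of the ring. All that is kept of this is the
  degree and that the entries of two rows agree where the two points coincide.
\<close>

definition evaluation_column :: "nat \<Rightarrow> nat \<Rightarrow> (nat \<Rightarrow> mpoly) \<Rightarrow> bool" where
  "evaluation_column n e g \<longleftrightarrow>
    (\<forall>r<n. g r \<in> carrier (poly_ring n) \<and> homogeneous e (g r)) \<and>
    (\<forall>a b. a < b \<longrightarrow> b < n \<longrightarrow> g b - g a \<in> pair_ideal n a b)"

lemma evaluation_column_coord: "evaluation_column n 1 (coord t)"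
  by (simp add: evaluation_column_def coord_carrier coord_homogeneous[simplified]
      coord_diff_pair_ideal')

lemma evaluation_column_const:
  "k \<in> carrier (poly_ring n) \<Longrightarrow> homogeneous e k \<Longrightarrow> evaluation_column n e (\<lambda>_. k)"
  by (simp add: evaluation_column_def ideal_zero[OF pair_ideal_ideal])

lemma evaluation_column_diff:
  assumes "evaluation_column n e g" "evaluation_column n e h"
  shows "evaluation_column n e (\<lambda>r. g r - h r)"
proof -
  have "g b - h b - (g a - h a) \<in> pair_ideal n a b" if "a < b" "b < n" for a b
    using ideal_diff[OF pair_ideal_ideal, of a n b "g b - g a" "h b - h a"] assms that
    by (simp add: evaluation_column_def algebra_simps)
  then show ?thesis
    using assms by (simp add: evaluation_column_def carrier_diff homogeneous_diff)
qed

lemma evaluation_column_mult: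
  assumes g: "evaluation_column n e g" and h: "evaluation_column n e' h"
  shows "evaluation_column n (e + e') (\<lambda>r. g r * h r)"
proof -
  have "g b * h b - g a * h a \<in> pair_ideal n a b" if "a < b" "b < n" for a b
  proof -
    have "a < n" using that by simp
    note I = pair_ideal_ideal[OF this \<open>b < n\<close>]
    have "(g b - g a) * h b + g a * (h b - h a) \<in> pair_ideal n a b"
      using g h that
      by (intro ideal_add[OF I] ideal_mult_left[OF I] ideal_mult_right[OF I])
        (auto simp: evaluation_column_def)
    then show ?thesis by (simp add: algebra_simps)
  qed
  then show ?thesis
    using g h by (simp add: evaluation_column_def carrier_mult homogeneous_mult)
qed

lemma evaluation_column_prod:
  assumes "finite A" "\<And>l. l \<in> A \<Longrightarrow> evaluation_column n (e l) (g l)"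
  shows "evaluation_column n (sum e A) (\<lambda>r. \<Prod>l\<in>A. g l r)"
  using assms
  by (induction A rule: finite_induct)
    (simp_all add: evaluation_column_const carrier_one homogeneous_one evaluation_column_mult)

lemma coldet_in_diag_ideal_below:
  assumes g: "\<And>c. c < n \<Longrightarrow> evaluation_column n (e c) (g c)" and "(\<Sum>c<n. e c) < d"
  shows "coldet n g \<in> diag_ideal_below n d"
proof (rule diag_ideal_belowI[OF diag_idealI])
  have entry: "g c r \<in> carrier (poly_ring n)" if "c < n" "r < n" for c r
    using g that by (simp add: evaluation_column_def)
  then show "coldet n g \<in> carrier (poly_ring n)"
    by (rule coldet_carrier)
  show "coldet n g \<in> pair_ideal n a b" if "a < b" "b < n" for a b
    using that g
    by (intro coldet_ideal_congruent_rows[OF pair_ideal_ideal, where a = a and b = b] entry)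
      (auto simp: evaluation_column_def)
  show "homogeneous (\<Sum>c<n. e c) (coldet n g)"
    using g by (intro coldet_homogeneous) (auto simp: evaluation_column_def)
qed fact

text \<open>
  One linear factor is treated at a time, the factor \<open>h\<close> collecting those that have been treated. By
  linearity in the column, the shift by \<open>k l\<close> costs \<open>k l\<close> times a determinant with one linear factor
  fewer, which is an element of \<open>I\<close> of degree less than \<open>d\<close>.
\<close>

lemma coldet_shift_column:
  assumes c: "c < n"
    and g: "\<And>b. b < n \<Longrightarrow> b \<noteq> c \<Longrightarrow> evaluation_column n (e b) (g b)"
    and "finite A"
    and k: "\<And>l. l \<in> A \<Longrightarrow> k l \<in> carrier (poly_ring n) \<and> homogeneous 1 (k l)"
    and "evaluation_column n m h"
    and "(\<Sum>b\<in>{..<n} - {c}. e b) + (m + card A) \<le> d"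
  shows "coldet n (g(c := \<lambda>r. h r * (\<Prod>l\<in>A. coord (\<tau> l) r - k l)))
       - coldet n (g(c := \<lambda>r. h r * (\<Prod>l\<in>A. coord (\<tau> l) r))) \<in> diag_ideal_below n d"
  using assms(3-)
proof (induction A arbitrary: m h rule: finite_induct)
  case empty
  show ?case by (simp add: ideal_zero[OF diag_ideal_below_ideal])
next
  case (insert l A)
  note I = diag_ideal_below_ideal[of n d]
  define h' where "h' = (\<lambda>r. h r * (coord (\<tau> l) r - k l))"
  let ?D = "\<lambda>u. coldet n (g(c := u))"
  let ?P = "\<lambda>r. \<Prod>l\<in>A. coord (\<tau> l) r"
  have kl: "k l \<in> carrier (poly_ring n)" "homogeneous 1 (k l)"
    using insert.prems(1) by simp_all
  have h': "evaluation_column n (m + 1) h'"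
    unfolding h'_def
    by (intro evaluation_column_mult evaluation_column_diff evaluation_column_coord
        evaluation_column_const insert.prems kl)
  have 1: "?D (\<lambda>r. h' r * (\<Prod>l\<in>A. coord (\<tau> l) r - k l)) - ?D (\<lambda>r. h' r * ?P r)
      \<in> diag_ideal_below n d"
    using insert.prems insert.hyps by (intro insert.IH[OF _ h']) auto
  have "?D (\<lambda>r. h r * ?P r) \<in> diag_ideal_below n d"
  proof (rule coldet_in_diag_ideal_below)
    show "evaluation_column n ((e(c := m + card A)) b) ((g(c := \<lambda>r. h r * ?P r)) b)"
      if "b < n" for b
      using g[OF that] evaluation_column_mult[OF insert.prems(2)
          evaluation_column_prod[OF insert.hyps(1) evaluation_column_coord]]
      by simp
    show "(\<Sum>b<n. (e(c := m + card A)) b) < d"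
      using insert.prems(3) insert.hyps c by (simp add: sum.remove[of "{..<n}" c])
  qed
  then have 2: "k l * ?D (\<lambda>r. h r * ?P r) \<in> diag_ideal_below n d"
    by (rule ideal_mult_left[OF I _ kl(1)])
  have "?D (\<lambda>r. h' r * ?P r) = ?D (\<lambda>r. h r * (coord (\<tau> l) r * ?P r) - k l * (h r * ?P r))"
    by (simp add: h'_def algebra_simps)
  also have "\<dots> = ?D (\<lambda>r. h r * (coord (\<tau> l) r * ?P r)) - k l * ?D (\<lambda>r. h r * ?P r)"
    by (rule coldet_linear[OF c])
  finally have "?D (\<lambda>r. h' r * (\<Prod>l\<in>A. coord (\<tau> l) r - k l))
      - ?D (\<lambda>r. h r * (coord (\<tau> l) r * ?P r)) \<in> diag_ideal_below n d"
    using ideal_diff[OF I 1 2] by simp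
  moreover have "(\<lambda>r. h' r * (\<Prod>l\<in>A. coord (\<tau> l) r - k l)) =
      (\<lambda>r. h r * (\<Prod>l\<in>insert l A. coord (\<tau> l) r - k l))"
    using insert.hyps by (simp add: h'_def mult.assoc)
  moreover have "(\<lambda>r. h r * (coord (\<tau> l) r * ?P r)) =
      (\<lambda>r. h r * (\<Prod>l\<in>insert l A. coord (\<tau> l) r))"
    using insert.hyps by simp
  ultimately have "?D (\<lambda>r. h r * (\<Prod>l\<in>insert l A. coord (\<tau> l) r - k l))
      - ?D (\<lambda>r. h r * (\<Prod>l\<in>insert l A. coord (\<tau> l) r)) \<in> diag_ideal_below n d"
    by simp
  then show ?case .
qed

section \<open>Newton columns\<close>

text \<open>
  The degree of a column can exceed the number \<open>n\<close> of points; beyond the last point the node is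
  \<open>0\<close>, so that the corresponding linear factors stay unshifted.
\<close>

definition node :: "nat \<Rightarrow> bool \<Rightarrow> nat \<Rightarrow> mpoly" where
  "node n t l = (if l < n then coord t l else 0)"

definition newton_column :: "nat \<Rightarrow> nat \<Rightarrow> (nat \<Rightarrow> bool) \<Rightarrow> nat \<Rightarrow> mpoly" where
  "newton_column n m \<tau> r = (\<Prod>l<m. coord (\<tau> l) r - node n (\<tau> l) l)"

lemma node_carrier: "node n t l \<in> carrier (poly_ring n)"
  by (simp add: node_def coord_carrier carrier_zero)

lemma node_homogeneous: "homogeneous 1 (node n t l)"
  by (simp add: node_def coord_homogeneous[simplified] homogeneous_zero)

lemma newton_column_evaluation: "evaluation_column n m (newton_column n m \<tau>)"
proof -
  have "evaluation_column n (\<Sum>l<m. 1) (\<lambda>r. \<Prod>l<m. coord (\<tau> l) r - node n (\<tau> l) l)"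
    by (intro evaluation_column_prod evaluation_column_diff evaluation_column_coord
        evaluation_column_const node_carrier node_homogeneous) simp
  then show ?thesis
    by (simp add: newton_column_def[abs_def])
qed

lemma newton_column_eq_0: "r < m \<Longrightarrow> r < n \<Longrightarrow> newton_column n m \<tau> r = 0"
  unfolding newton_column_def by (rule prod_zero) (auto simp: node_def)

text \<open>
  The columns are shifted one after the other: \<open>g k\<close> is the stage at which the first \<open>k\<close> of them
  have been shifted.
\<close>

lemma coldet_newton:
  assumes "(\<Sum>c<n. t c) \<le> d"
  shows "coldet n (\<lambda>c. newton_column n (t c) (\<tau> c))
       - coldet n (\<lambda>c r. \<Prod>l<t c. coord (\<tau> c l) r) \<in> diag_ideal_below n d"
proof -
  let ?M = "\<lambda>c r. \<Prod>l<t c. coord (\<tau> c l) r"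
  define g where "g k c = (if c < k then newton_column n (t c) (\<tau> c) else ?M c)" for k c
  have M: "evaluation_column n (t c) (?M c)" for c
    using evaluation_column_prod[of "{..<t c}" n "\<lambda>_. 1" "\<lambda>l. coord (\<tau> c l)"]
      evaluation_column_coord by simp
  have "coldet n (g k) - coldet n ?M \<in> diag_ideal_below n d" if "k \<le> n" for k
    using that
  proof (induction k)
    case 0
    show ?case by (simp add: g_def ideal_zero[OF diag_ideal_below_ideal])
  next
    case (Suc k)
    have "coldet n ((g k)(k := \<lambda>r. 1 * (\<Prod>l\<in>{..<t k}. coord (\<tau> k l) r - node n (\<tau> k l) l)))
        - coldet n ((g k)(k := \<lambda>r. 1 * (\<Prod>l\<in>{..<t k}. coord (\<tau> k l) r)))
        \<in> diag_ideal_below n d"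
    proof (rule coldet_shift_column)
      show "evaluation_column n (t b) (g k b)" for b
        using M by (simp add: g_def newton_column_evaluation)
      show "evaluation_column n 0 (\<lambda>_. 1)"
        by (simp add: evaluation_column_const carrier_one homogeneous_one)
      show "(\<Sum>b\<in>{..<n} - {k}. t b) + (0 + card {..<t k}) \<le> d"
        using assms Suc.prems by (simp add: sum.remove[of "{..<n}" k])
    qed (use Suc.prems in \<open>simp_all add: node_carrier node_homogeneous[simplified]\<close>)
    moreover have "(g k)(k := \<lambda>r. 1 * (\<Prod>l\<in>{..<t k}. coord (\<tau> k l) r - node n (\<tau> k l) l))
        = g (Suc k)"
      by (auto simp: g_def newton_column_def less_Suc_eq fun_eq_iff)
    moreover have "(g k)(k := \<lambda>r. 1 * (\<Prod>l\<in>{..<t k}. coord (\<tau> k l) r)) = g k"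
      by (auto simp: g_def)
    ultimately have "coldet n (g (Suc k)) - coldet n (g k) \<in> diag_ideal_below n d"
      by simp
    from ideal_add[OF diag_ideal_below_ideal this Suc.IH] Suc.prems show ?case
      by simp
  qed
  from this[of n] have "coldet n (g n) - coldet n ?M \<in> diag_ideal_below n d"
    by simp
  moreover have "coldet n (g n) = coldet n (\<lambda>c. newton_column n (t c) (\<tau> c))"
    by (rule coldet_cong) (simp add: g_def)
  ultimately show ?thesis by simp
qed

lemma Delta_eq_coldet:
  assumes "\<And>c. c < n \<Longrightarrow> card {l. l < t c \<and> \<tau> c l} = fst (P (c + 1))"
    and "\<And>c. c < n \<Longrightarrow> t c = fst (P (c + 1)) + snd (P (c + 1))"
  shows "Delta n P = coldet n (\<lambda>c r. \<Prod>l<t c. coord (\<tau> c l) r)"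
proof -
  have "(\<Prod>l<t c. coord (\<tau> c l) r) =
      indet (Xvar (r + 1)) ^ fst (P (c + 1)) * indet (Yvar (r + 1)) ^ snd (P (c + 1))"
    if "c < n" for c r
  proof -
    let ?S = "{l. l < t c \<and> \<tau> c l}"
    have S: "?S \<subseteq> {..<t c}" by auto
    have "(\<Prod>l<t c. coord (\<tau> c l) r) =
        (\<Prod>l\<in>{..<t c} - ?S. coord (\<tau> c l) r) * (\<Prod>l\<in>?S. coord (\<tau> c l) r)"
      by (rule prod.subset_diff[OF S]) simp
    also have "(\<Prod>l\<in>?S. coord (\<tau> c l) r) = (\<Prod>l\<in>?S. coord True r)"
      by (rule prod.cong) auto
    also have "(\<Prod>l\<in>{..<t c} - ?S. coord (\<tau> c l) r) = (\<Prod>l\<in>{..<t c} - ?S. coord False r)"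
      by (rule prod.cong) auto
    finally show ?thesis
      using assms[OF that] S by (simp add: coord_def card_Diff_subset mult.commute)
  qed
  then show ?thesis
    unfolding Delta_def coldet_def by (intro arg_cong[where f = det] cong_mat) simp_all
qed

section \<open>Exchanging the types of two linear factors\<close>

text \<open>
  The cofactor \<open>W\<close> that is left when the blocks at \<open>i\<close> and \<open>j\<close> have been factored out already
  vanishes at all coincidences \<open>z\<^sub>a = z\<^sub>b\<close> with \<open>a < b\<close>, except those with \<open>b = i\<close> or
  \<open>b = j\<close>. If \<open>a\<close> is neither \<open>i\<close> nor \<open>j\<close>, two rows become equal. If \<open>a\<close> is \<open>i\<close> or
  \<open>j\<close>, then row \<open>b\<close> lies below the cut after \<open>a\<close>: in the columns right of the cut its entries are
  congruent to those of row \<open>a\<close>, which vanish, and Leibniz terms that use a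
  column left of the cut die by the crossing argument.
\<close>

lemma coldet_minor_in_pair_ideal:
  assumes ij: "i < j" "j < n"
    and h: "\<And>c. c < n \<Longrightarrow> c \<noteq> i \<Longrightarrow> c \<noteq> j \<Longrightarrow> evaluation_column n (e c) (h c)"
    and hi: "h i = (\<lambda>r. if r = i then 1 else 0)" and hj: "h j = (\<lambda>r. if r = j then 1 else 0)"
    and zero: "\<And>a c r. a \<in> {i, j} \<Longrightarrow> a < c \<Longrightarrow> c < n \<Longrightarrow> c \<noteq> j \<Longrightarrow> r \<le> a \<Longrightarrow> h c r = 0"
    and ab: "a < b" "b < n" "b \<noteq> i" "b \<noteq> j"
  shows "coldet n h \<in> pair_ideal n a b"
proof -
  have "a < n" using ab by simp
  note I = pair_ideal_ideal[OF this \<open>b < n\<close>]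
  have entry: "h c r \<in> carrier (poly_ring n)" if "c < n" "r < n" for c r
    using h[of c] that
    by (cases "c = i \<or> c = j")
      (auto simp: hi hj evaluation_column_def carrier_one carrier_zero)
  have cong: "h c b - h c a \<in> pair_ideal n a b" if "c < n" "c \<noteq> i" "c \<noteq> j" for c
    using h[OF that] ab by (simp add: evaluation_column_def)
  show ?thesis
  proof (cases "a = i \<or> a = j")
    case False
    show ?thesis
    proof (rule coldet_ideal_congruent_rows[OF I entry])
      show "h c b - h c a \<in> pair_ideal n a b" if "c < n" for c
        using cong[OF that] False ab
        by (cases "c = i \<or> c = j") (auto simp: hi hj ideal_zero[OF I])
    qed (use ab in auto)
  next
    case True
    have zero': "h c r = 0" if "a < c" "c < n" "r \<le> a" for c r
      using zero[of a c r] True that ij by (cases "c = j") (auto simp: hj)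
    show ?thesis
    proof (rule coldet_ideal[OF I entry])
      fix p assume p: "p permutes {0..<n}"
      define c where "c = Hilbert_Choice.inv p b"
      have pc: "p c = b" and c: "c < n"
        using permutes_inverses(1)[OF p, of b] permutes_less[OF p, of c] ab by (auto simp: c_def)
      show "\<exists>c<n. h c (p c) \<in> pair_ideal n a b"
      proof (cases "a < c")
        case True
        then have "h c b \<in> pair_ideal n a b"
          using cong[OF c] \<open>a = i \<or> a = j\<close> zero'[OF True c order.refl] ideal_zero[OF I] ij ab
          by (cases "c = j") (auto simp: hj)
        then show ?thesis using pc c by blast
      next
        case False
        then obtain c' where "a < c'" "c' < n" "p c' \<le> a"
          using permutes_crossing[OF p, of c a] pc c ab by auto
        then show ?thesis
          using zero' ideal_zero[OF I] by force
      qed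
    qed
  qed
qed

text \<open>The determinant of the vectors from \<open>z\<^sub>a\<close> to \<open>z\<^sub>b\<close> and from \<open>z\<^sub>b\<close> to \<open>z\<^sub>c\<close>, up to sign.\<close>

definition area :: "nat \<Rightarrow> nat \<Rightarrow> nat \<Rightarrow> mpoly" where
  "area a b c = (coord False b - coord False a) * (coord True c - coord True b)
    - (coord True b - coord True a) * (coord False c - coord False b)"

lemma area_in_pair_ideal:
  assumes "a < n" "b < n" "c < n"
  shows "area a b c \<in> pair_ideal n a b" "area a b c \<in> pair_ideal n b c"
    and "area a b c \<in> pair_ideal n a c"
proof -
  note I = pair_ideal_ideal
  note m = coord_diff_pair_ideal' carrier_diff coord_carrier
  show "area a b c \<in> pair_ideal n a b"
    unfolding area_def using assms
    by (intro ideal_diff[OF I] ideal_mult_right[OF I] m) auto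
  show "area a b c \<in> pair_ideal n b c"
    unfolding area_def using assms
    by (intro ideal_diff[OF I] ideal_mult_left[OF I] m) auto
  \<comment> \<open>The same determinant with the second vector starting at \<open>z\<^sub>a\<close> instead.\<close>
  have "area a b c = (coord False b - coord False a) * (coord True c - coord True a)
      - (coord True b - coord True a) * (coord False c - coord False a)"
    by (simp add: area_def algebra_simps)
  also have "\<dots> \<in> pair_ideal n a c"
    using assms by (intro ideal_diff[OF I] ideal_mult_left[OF I] m) auto
  finally show "area a b c \<in> pair_ideal n a c" .
qed

text \<open>
  In the proof, \<open>L m l\<close> is the linear factor of column \<open>m\<close> for the node \<open>l\<close>, evaluated at
  \<open>z\<^sub>m\<close>. With \<open>E\<close> and \<open>F\<close> the products of the \<open>L i l\<close> and the \<open>L j l\<close> over the nodes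
  \<open>l\<close> other than \<open>0\<close> and \<open>i\<close>, which are the same on both sides, the difference is
  \<open>L j 0\<close> times \<open>W * E * F * area 0 i j\<close>. The latter product lies in \<open>I\<close>: for pairs \<open>a < b\<close> with
  \<open>b = i\<close>, the factor needed is in \<open>E\<close> or is the area form; for \<open>b = j\<close>, it is in \<open>F\<close> or is the
  area form; for the other pairs it is \<open>W\<close>. Its degree is smaller by one since \<open>L j 0\<close> is linear.
\<close>

lemma coldet_exchange:
  fixes t :: "nat \<Rightarrow> nat" and \<tau> \<tau>' :: "nat \<Rightarrow> nat \<Rightarrow> bool"
  assumes ij: "0 < i" "i < j" "j < n"
    and t: "t i = i" "t j = j"
    and above: "\<And>c. i < c \<Longrightarrow> c < n \<Longrightarrow> i < t c" "\<And>c. j < c \<Longrightarrow> c < n \<Longrightarrow> j < t c"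
    and \<tau>: "\<not> \<tau> i 0" "\<tau> j i"
    and \<tau>': "\<tau>' = \<tau>(i := (\<tau> i)(0 := True), j := (\<tau> j)(i := False))"
  shows "coldet n (\<lambda>c. newton_column n (t c) (\<tau> c)) - coldet n (\<lambda>c. newton_column n (t c) (\<tau>' c))
    \<in> diag_ideal_below n (\<Sum>c<n. t c)"
proof -
  let ?one = "\<lambda>i r. (if r = i then 1 else 0) :: mpoly"
  define h where "h = (\<lambda>c. newton_column n (t c) (\<tau> c))(i := ?one i, j := ?one j)"
  define W where "W = coldet n h"
  have factored: "coldet n (\<lambda>c. newton_column n (t c) (\<sigma> c)) =
      newton_column n i (\<sigma> i) i * (newton_column n j (\<sigma> j) j * W)"
    if "\<sigma> = \<tau> \<or> \<sigma> = \<tau>'" for \<sigma>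
  proof -
    let ?g = "\<lambda>c. newton_column n (t c) (\<sigma> c)"
    have z: "newton_column n (t c) (\<sigma> c) r = 0"
      if "a \<in> {i, j}" "a < c \<and> r \<le> a \<or> a = c \<and> r < a" "c < n" for a c r
      using that above[of c] t by (intro newton_column_eq_0) auto
    have "coldet n ?g = ?g i i * coldet n (?g(i := ?one i))"
      using ij by (intro coldet_factor_out z[of i]) auto
    also have "coldet n (?g(i := ?one i)) =
        (?g(i := ?one i)) j j * coldet n ((?g(i := ?one i))(j := ?one j))"
      using ij z[of j] by (intro coldet_factor_out) auto
    also have "(?g(i := ?one i))(j := ?one j) = h"
      using that by (auto simp: h_def \<tau>')
    finally show ?thesis
      using ij by (simp add: W_def t)
  qed
  define L where "L m l = coord (\<tau> m l) m - coord (\<tau> m l) l" for m l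
  define E where "E = (\<Prod>l\<in>{1..<i}. L i l)"
  define F where "F = (\<Prod>l\<in>{1..<j} - {i}. L j l)"
  have L: "L m l \<in> carrier (poly_ring n)" "L m l \<in> pair_ideal n l m" "homogeneous 1 (L m l)"
    if "l < n" "m < n" for l m
    using that by (simp_all add: L_def coord_carrier carrier_diff coord_diff_pair_ideal'
        homogeneous_diff[OF coord_homogeneous coord_homogeneous, simplified])
  have newton: "newton_column n m \<sigma> m = (\<Prod>l<m. coord (\<sigma> l) m - coord (\<sigma> l) l)"
    if "m < n" for m \<sigma>
    unfolding newton_column_def using that by (intro prod.cong) (auto simp: node_def)
  have lessi: "{..<i} = insert 0 {1..<i}" and
    lessj: "{..<j} = insert i (insert 0 ({1..<j} - {i}))"
    using ij by auto
  have v1: "newton_column n i (\<tau> i) i = (coord False i - coord False 0) * E"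
    using ij \<tau> unfolding newton[OF less_trans[OF ij(2,3)]] lessi
    by (simp add: E_def L_def)
  have v2: "newton_column n i (\<tau>' i) i = (coord True i - coord True 0) * E"
    using ij unfolding newton[OF less_trans[OF ij(2,3)]] lessi
    by (simp add: E_def L_def \<tau>')
  have v3: "newton_column n j (\<tau> j) j = (coord True j - coord True i) * (L j 0 * F)"
    using ij \<tau> unfolding newton[OF ij(3)] lessj
    by (simp add: F_def L_def)
  have v4: "newton_column n j (\<tau>' j) j = (coord False j - coord False i) * (L j 0 * F)"
  proof -
    have "(\<Prod>l\<in>{1..<j} - {i}. coord (\<tau>' j l) j - coord (\<tau>' j l) l) = F"
      unfolding F_def by (rule prod.cong) (auto simp: L_def \<tau>')
    then show ?thesis
      using ij unfolding newton[OF ij(3)] lessj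
      by (simp add: L_def \<tau>')
  qed
  have difference:
    "coldet n (\<lambda>c. newton_column n (t c) (\<tau> c)) - coldet n (\<lambda>c. newton_column n (t c) (\<tau>' c))
      = L j 0 * (W * E * F * area 0 i j)"
    unfolding factored[of \<tau>, simplified] factored[of \<tau>', simplified] v1 v2 v3 v4 area_def
    by (simp add: algebra_simps)
  have hcol: "evaluation_column n (t c) (h c)" if "c \<noteq> i" "c \<noteq> j" for c
    using that by (simp add: h_def newton_column_evaluation)
  have carrier: "W \<in> carrier (poly_ring n)" "E \<in> carrier (poly_ring n)"
    "F \<in> carrier (poly_ring n)" "area 0 i j \<in> carrier (poly_ring n)"
  proof -
    have "h c r \<in> carrier (poly_ring n)" if "r < n" for c r
      using newton_column_evaluation[of n "t c" "\<tau> c"] that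
      by (auto simp: h_def carrier_one carrier_zero evaluation_column_def)
    then show "W \<in> carrier (poly_ring n)"
      unfolding W_def by (rule coldet_carrier)
    show "E \<in> carrier (poly_ring n)" "F \<in> carrier (poly_ring n)"
      unfolding E_def F_def using ij by (intro carrier_prod L; simp)+
    show "area 0 i j \<in> carrier (poly_ring n)"
      unfolding area_def using ij by (intro carrier_diff carrier_mult coord_carrier) auto
  qed
  have "W * E * F * area 0 i j \<in> diag_ideal n"
  proof (rule diag_idealI)
    show "W * E * F * area 0 i j \<in> carrier (poly_ring n)"
      by (intro carrier_mult carrier)
    fix a b assume ab: "a < b" "b < n"
    then have "a < n" by simp
    note I = pair_ideal_ideal[OF this \<open>b < n\<close>]
    consider "b \<noteq> i" "b \<noteq> j" | "b = i" "a = 0" | "b = i" "a \<noteq> 0"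
      | "b = j" "a = 0" | "b = j" "a = i" | "b = j" "a \<noteq> 0" "a \<noteq> i"
      by blast
    then have "W \<in> pair_ideal n a b \<or> E \<in> pair_ideal n a b \<or> F \<in> pair_ideal n a b
        \<or> area 0 i j \<in> pair_ideal n a b"
    proof cases
      case 1
      have "h c r = 0" if "q \<in> {i, j}" "q < c" "c < n" "c \<noteq> j" "r \<le> q" for q c r
        using that above[of c] ij by (auto simp: h_def intro!: newton_column_eq_0)
      then have "W \<in> pair_ideal n a b"
        unfolding W_def using ij ab 1
        by (intro coldet_minor_in_pair_ideal[of i j n t] hcol) (auto simp: h_def)
      then show ?thesis by blast
    next
      case 3
      then have "E \<in> pair_ideal n a b"
        unfolding E_def using ij ab by (intro ideal_prod[OF I, of _ a]) (auto intro!: L)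
      then show ?thesis by blast
    next
      case 6
      then have "F \<in> pair_ideal n a b"
        unfolding F_def using ij ab by (intro ideal_prod[OF I, of _ a]) (auto intro!: L)
      then show ?thesis by blast
    qed (use area_in_pair_ideal[of 0 n i j] ij in auto)
    then show "W * E * F * area 0 i j \<in> pair_ideal n a b"
      by (elim disjE) (simp_all add: ideal_mult_left[OF I] ideal_mult_right[OF I] carrier_mult carrier)
  qed
  moreover have "homogeneous ((\<Sum>c<n. t c) - 1) (W * E * F * area 0 i j)"
  proof -
    let ?e = "t(i := 0, j := 0)"
    have W: "homogeneous (\<Sum>c<n. ?e c) W"
      unfolding W_def
    proof (rule coldet_homogeneous)
      show "homogeneous (?e c) (h c r)" if "r < n" for c r
        using hcol[of c] that
        by (cases "c = i \<or> c = j")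
          (auto simp: h_def evaluation_column_def homogeneous_one homogeneous_zero)
    qed
    have E: "homogeneous (\<Sum>l\<in>{1..<i}. 1) E" and F: "homogeneous (\<Sum>l\<in>{1..<j} - {i}. 1) F"
      unfolding E_def F_def using ij by (intro homogeneous_prod L; simp)+
    have A: "homogeneous (1 + 1) (area 0 i j)"
      unfolding area_def
      by (intro homogeneous_diff[OF homogeneous_mult homogeneous_mult] homogeneous_diff
          coord_homogeneous)
    have sum: "(\<Sum>c<n. u c) = u i + u j + (\<Sum>c\<in>{..<n} - {i} - {j}. u c)" for u :: "nat \<Rightarrow> nat"
      using ij by (simp add: sum.remove[of "{..<n}" i] sum.remove[of "{..<n} - {i}" j])
    have "(\<Sum>c\<in>{..<n} - {i} - {j}. ?e c) = (\<Sum>c\<in>{..<n} - {i} - {j}. t c)"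
      by (rule sum.cong) auto
    then have "(\<Sum>c<n. ?e c) + (\<Sum>l\<in>{1..<i}. 1) + (\<Sum>l\<in>{1..<j} - {i}. 1) + (1 + 1)
        = (\<Sum>c<n. t c) - 1"
      unfolding sum using ij t by simp
    then show ?thesis
      using homogeneous_mult[OF homogeneous_mult[OF homogeneous_mult[OF W E] F] A] by simp
  qed
  moreover have "(\<Sum>c<n. t c) - 1 < (\<Sum>c<n. t c)"
    using member_le_sum[of j "{..<n}" t] ij t by simp
  ultimately have "W * E * F * area 0 i j \<in> diag_ideal_below n (\<Sum>c<n. t c)"
    by (rule diag_ideal_belowI)
  from ideal_mult_left[OF diag_ideal_below_ideal this L(1)[of 0 j]] ij show ?thesis
    unfolding difference by simp
qed

text \<open>
  The letters are chosen to fit the exchange. In column \<open>i\<close>, the node \<open>0\<close> gets a \<open>y\<close>, which is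
  possible as \<open>\<beta> > 0\<close>; in column \<open>j\<close>, the node \<open>i\<close> gets an \<open>x\<close>, which is possible as
  \<open>\<alpha> > 0\<close>. Flipping these two letters realises the move of the two points.
\<close>

lemma Delta_move:
  fixes t :: "nat \<Rightarrow> nat"
  assumes t: "\<And>c. c < n \<Longrightarrow> t c = fst (P (c + 1)) + snd (P (c + 1))"
    and ij: "i < j" "j < n" "t i = i" "t j = j"
    and above: "\<And>c. i < c \<Longrightarrow> c < n \<Longrightarrow> i < t c" "\<And>c. j < c \<Longrightarrow> c < n \<Longrightarrow> j < t c"
    and pos: "0 < snd (P (i + 1))" "0 < fst (P (j + 1))"
    and P': "P' = P(i + 1 := (fst (P (i + 1)) + 1, snd (P (i + 1)) - 1),
                    j + 1 := (fst (P (j + 1)) - 1, snd (P (j + 1)) + 1))"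
  shows "Delta n P - Delta n P' \<in> diag_ideal_below n (\<Sum>c<n. t c)"
proof -
  note I = diag_ideal_below_ideal[of n "\<Sum>c<n. t c"]
  note shift = coldet_newton[OF order.refl, where n = n and t = t]
  have ti: "i = fst (P (i + 1)) + snd (P (i + 1))" and tj: "j = fst (P (j + 1)) + snd (P (j + 1))"
    using t[of i] t[of j] ij by simp_all
  obtain V where V: "V \<subseteq> {1..<i}" "card V = fst (P (i + 1))"
  proof (rule obtain_subset_with_card_n)
    show "fst (P (i + 1)) \<le> card {1..<i}"
      using ti pos by simp
  qed blast
  obtain U where U: "U \<subseteq> {..<j} - {i}" "card U = fst (P (j + 1)) - 1"
  proof (rule obtain_subset_with_card_n)
    show "fst (P (j + 1)) - 1 \<le> card ({..<j} - {i})"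
      using ij tj by simp
  qed blast
  have fin: "finite V" "finite U"
    using V(1) U(1) by (auto intro: finite_subset)
  define \<tau> where "\<tau> = (\<lambda>c l. l < fst (P (c + 1)))(i := (\<lambda>l. l \<in> V), j := (\<lambda>l. l \<in> insert i U))"
  define \<tau>' where "\<tau>' = \<tau>(i := (\<tau> i)(0 := True), j := (\<tau> j)(i := False))"
  have set_\<tau>: "{l. l < i \<and> \<tau> i l} = V" "{l. l < j \<and> \<tau> j l} = insert i U"
    using V(1) U(1) ij by (auto simp: \<tau>_def)
  have set_\<tau>': "{l. l < i \<and> \<tau>' i l} = insert 0 V" "{l. l < j \<and> \<tau>' j l} = U"
    using V(1) U(1) ij ti pos by (auto simp: \<tau>'_def \<tau>_def)
  have other: "{l. l < t c \<and> \<tau> c l} = {..<fst (P (c + 1))}" "\<tau>' c = \<tau> c"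
    if "c < n" "c \<noteq> i" "c \<noteq> j" for c
    using that t[of c] by (auto simp: \<tau>'_def \<tau>_def)
  have notin: "0 \<notin> V" "i \<notin> U"
    using V U by auto
  have "Delta n P = coldet n (\<lambda>c r. \<Prod>l<t c. coord (\<tau> c l) r)"
  proof (rule Delta_eq_coldet)
    show "card {l. l < t c \<and> \<tau> c l} = fst (P (c + 1))" if "c < n" for c
      using that ij fin V(2) U(2) notin pos
      by (cases "c = i"; cases "c = j") (simp_all add: set_\<tau> other)
  qed (rule t)
  moreover have "Delta n P' = coldet n (\<lambda>c r. \<Prod>l<t c. coord (\<tau>' c l) r)"
  proof (rule Delta_eq_coldet)
    show "card {l. l < t c \<and> \<tau>' c l} = fst (P' (c + 1))" if "c < n" for c
      using that ij fin V(2) U(2) notin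
      by (cases "c = i"; cases "c = j") (simp_all add: set_\<tau>' other P')
    show "t c = fst (P' (c + 1)) + snd (P' (c + 1))" if "c < n" for c
      using t[OF that] pos by (auto simp: P')
  qed
  moreover have "coldet n (\<lambda>c. newton_column n (t c) (\<tau> c))
      - coldet n (\<lambda>c. newton_column n (t c) (\<tau>' c)) \<in> diag_ideal_below n (\<Sum>c<n. t c)"
    using ij above notin ti pos
    by (intro coldet_exchange[OF _ _ _ _ _ _ _ _ _ \<tau>'_def]) (auto simp: \<tau>_def)
  ultimately show ?thesis
    using ideal_add[OF I ideal_diff[OF I _ shift[of \<tau>]] shift[of \<tau>']]
    by fastforce
qed

theorem lemma22:
  fixes n d i j :: nat
    and P P' :: "nat \<Rightarrow> nat \<times> nat"
    and s :: "nat \<Rightarrow> nat"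
  assumes distinct: "inj_on P {1..n}"
    and s: "\<And>k. 1 \<le> k \<Longrightarrow> k \<le> n \<Longrightarrow> s k = fst (P k) + snd (P k)"
    and s_mono: "\<And>k. 1 \<le> k \<Longrightarrow> k < n \<Longrightarrow> s k \<le> s (k + 1)"
    and d: "d = (\<Sum>k = 1..n. s k)"
    and s_last: "s (n + 1) = n"
    and i_range: "1 \<le> i" "i \<le> n"
    and j_range: "1 \<le> j" "j \<le> n"
    and ij: "i \<noteq> j"
    and si: "s i = i - 1" "s (i + 1) = i"
    and sj: "s j = j - 1" "s (j + 1) = j"
    and beta_pos: "snd (P i) > 0"
    and alpha_pos: "fst (P j) > 0"
    and P': "P' = P(i := (fst (P i) + 1, snd (P i) - 1), j := (fst (P j) - 1, snd (P j) + 1))"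
  shows "Delta n P - Delta n P' \<in> diag_ideal_below n d"
proof -
  define t where "t c = s (c + 1)" for c
  have d': "d = (\<Sum>c<n. t c)"
    unfolding d t_def by (rule sum.reindex_bij_witness[of _ Suc "\<lambda>k. k - 1"]) auto
  have mono: "s a \<le> s b" if "a \<le> b" "1 \<le> a" "b \<le> n" for a b
    using that
  proof (induction b rule: dec_induct)
    case (step b)
    then show ?case
      using s_mono[of b] by simp
  qed simp
  have above: "k - 1 < t c" if "s (k + 1) = k" "1 \<le> k" "k - 1 < c" "c < n" for k c
  proof -
    have "k \<le> c" using that by simp
    then show ?thesis
      using mono[of "k + 1" "c + 1"] that by (simp add: t_def)
  qed
  show ?thesis
  proof (cases "i < j")
    case True
    show ?thesis
      unfolding d'
      using True i_range j_range si sj beta_pos alpha_pos s above[of i] above[of j]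
      by (intro Delta_move[of n t P "i - 1" "j - 1"]) (auto simp: t_def P')
  next
    case False
    \<comment> \<open>The move from \<open>P'\<close> back to \<open>P\<close> is of the same kind, with \<open>i\<close> and \<open>j\<close> exchanged.\<close>
    have "P = P'(j := (fst (P' j) + 1, snd (P' j) - 1), i := (fst (P' i) - 1, snd (P' i) + 1))"
      using ij beta_pos alpha_pos by (auto simp: P' fun_eq_iff)
    then have "Delta n P' - Delta n P \<in> diag_ideal_below n d"
      unfolding d'
      using False ij i_range j_range si sj beta_pos alpha_pos s above[of i] above[of j]
      by (intro Delta_move[of n t P' "j - 1" "i - 1"]) (auto simp: t_def P')
    then show ?thesis
      using ideal_uminus[OF diag_ideal_below_ideal] by fastforce
  qed
qed

end
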